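(* Let $S$ be a double interchange semigroup with operations $\triangle$ and $\blacktriangle$. Then for all $a,b,c,d,e,f,g,h,i,j \in S$, $$(a \triangle (b \blacktriangle c))\blacktriangle \Big(((d \triangle e)\blacktriangle i)\triangle (((f\triangle g)\triangle h)\blacktriangle j)\Big) = (a \triangle (b \blacktriangle c))\blacktriangle \Big(((d \triangle e)\blacktriangle i)\triangle (((g\triangle f)\triangle h)\blacktriangle j)\Big).$$
   Context: A double interchange semigroup is a nonempty set $S$ with two binary operations $\triangle, \blacktriangle \colon S\times S\to S$, each of which is associative, and which satisfy the interchange law $(a \triangle b)\blacktriangle(c\triangle d) = (a\blacktriangle c)\triangle(b\blacktriangle d)$ for all $a,b,c,d\in S$. No unit elements are assumed. *)

theory Defs
  imports Main
begin

text \<open>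
  The underlying set is an explicit carrier, as in HOL-Algebra, rather than a whole type: the
  operations are total functions on the type, but are constrained on the carrier only. The symbol \<open>\<diamondop>\<close> stands for the filled triangle.
\<close>

locale double_interchange_semigroup =
  fixes S :: "'a set"
    and white :: "'a \<Rightarrow> 'a \<Rightarrow> 'a"  (infixl \<open>\<triangle>\<close> 70)
    and black :: "'a \<Rightarrow> 'a \<Rightarrow> 'a"  (infixl \<open>\<diamondop>\<close> 70)
  assumes nonempty: "S \<noteq> {}"
    and white_closed: "\<lbrakk>a \<in> S; b \<in> S\<rbrakk> \<Longrightarrow> a \<triangle> b \<in> S"
    and black_closed: "\<lbrakk>a \<in> S; b \<in> S\<rbrakk> \<Longrightarrow> a \<diamondop> b \<in> S"
    and white_assoc: "\<lbrakk>a \<in> S; b \<in> S; c \<in> S\<rbrakk> \<Longrightarrow> (a \<triangle> b) \<triangle> c = a \<triangle> (b \<triangle> c)"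
    and black_assoc: "\<lbrakk>a \<in> S; b \<in> S; c \<in> S\<rbrakk> \<Longrightarrow> (a \<diamondop> b) \<diamondop> c = a \<diamondop> (b \<diamondop> c)"
    and interchange: "\<lbrakk>a \<in> S; b \<in> S; c \<in> S; d \<in> S\<rbrakk> \<Longrightarrow>
      (a \<triangle> b) \<diamondop> (c \<triangle> d) = (a \<diamondop> c) \<triangle> (b \<diamondop> d)"

end

theory Submission
  imports Defs
begin

text \<open>
  Read \<open>\<triangle>\<close> as horizontal juxtaposition and \<open>\<diamondop>\<close> as vertical stacking, so that both sides are
  subdivided squares. By the interchange law, two stacked rows are cut into columns, and any
  splitting of each row into a left and a right part will do: the cuts need not be aligned
  beforehand. A factor stacked in the right-hand part of one row therefore belongs equally well to
  the last entry of the row next to it (lemma \<open>slide\<close>).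

  After one interchange in the lower half, both sides of the theorem consist of a top row
  \<open>a \<triangle> (b \<diamondop> c)\<close>, a bottom row \<open>i \<triangle> j\<close>, and a middle row, in which \<open>f\<close> and \<open>g\<close> have to
  change places, somewhere between a first and a last entry.

  Sliding \<open>c\<close> down into the middle row and the last entry of that row down into the bottom row
  leaves \<open>c\<close> at the end of the middle row, next to \<open>g\<close>. Now \<open>g \<triangle> c\<close> can be taken as a single
  entry, and the two slides are undone: \<open>g\<close> has left the middle row and is parked beside \<open>c\<close> in the
  top row (lemma \<open>extract_from_row\<close>). The same move read backwards puts \<open>g\<close> back at any interior
  position of the middle row, since associativity allows everything to the right of that position to
  be counted as the last entry. Reinserting \<open>g\<close> to the left of \<open>f\<close> gives the theorem.
\<close>

context double_interchange_semigroup
begin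

text \<open>
  Cut both rows vertically in front of their last entry. The right-hand columns
  are \<open>(b \<diamondop> c) \<diamondop> k\<close> and \<open>b \<diamondop> (c \<diamondop> k)\<close>.
\<close>
lemma slide:
  assumes "a \<in> S" "b \<in> S" "c \<in> S" "r \<in> S" "k \<in> S"
  shows "(a \<triangle> (b \<diamondop> c)) \<diamondop> (r \<triangle> k) = (a \<triangle> b) \<diamondop> (r \<triangle> (c \<diamondop> k))"
  using assms by (simp add: interchange black_assoc black_closed)

text \<open>
  Two slides, one across each border of the middle row, together replace the last entry of that row:
  \<open>c\<close> enters from above and \<open>k\<close> leaves below.
\<close>
lemma double_slide:
  assumes "a \<in> S" "b \<in> S" "c \<in> S" "r \<in> S" "k \<in> S" "i \<in> S" "j \<in> S"
  shows "(a \<triangle> (b \<diamondop> c)) \<diamondop> ((r \<triangle> k) \<diamondop> (i \<triangle> j)) =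
         (a \<triangle> b) \<diamondop> ((r \<triangle> c) \<diamondop> (i \<triangle> (k \<diamondop> j)))"
proof -
  have "(a \<triangle> (b \<diamondop> c)) \<diamondop> ((r \<triangle> k) \<diamondop> (i \<triangle> j)) =
        ((a \<triangle> (b \<diamondop> c)) \<diamondop> (r \<triangle> k)) \<diamondop> (i \<triangle> j)"
    using assms by (simp add: black_assoc white_closed black_closed)
  also have "\<dots> = ((a \<triangle> b) \<diamondop> (r \<triangle> (c \<diamondop> k))) \<diamondop> (i \<triangle> j)"
    using assms by (simp only: slide)
  also have "\<dots> = (a \<triangle> b) \<diamondop> ((r \<triangle> (c \<diamondop> k)) \<diamondop> (i \<triangle> j))"
    using assms by (simp add: black_assoc white_closed black_closed)
  also have "\<dots> = (a \<triangle> b) \<diamondop> ((r \<triangle> c) \<diamondop> (i \<triangle> (k \<diamondop> j)))"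
    using assms by (simp only: slide)
  finally show ?thesis .
qed

text \<open>
  Slide \<open>c\<close> in and \<open>k\<close> out, regroup \<open>(u \<triangle> g) \<triangle> c\<close> as \<open>u \<triangle> (g \<triangle> c)\<close>, and slide back with
  \<open>g \<triangle> c\<close> in the role of \<open>c\<close>.
\<close>
lemma extract_from_row:
  assumes "a \<in> S" "b \<in> S" "c \<in> S" "u \<in> S" "g \<in> S" "k \<in> S" "i \<in> S" "j \<in> S"
  shows "(a \<triangle> (b \<diamondop> c)) \<diamondop> (((u \<triangle> g) \<triangle> k) \<diamondop> (i \<triangle> j)) =
         (a \<triangle> (b \<diamondop> (g \<triangle> c))) \<diamondop> ((u \<triangle> k) \<diamondop> (i \<triangle> j))"
proof -
  have "(a \<triangle> (b \<diamondop> c)) \<diamondop> (((u \<triangle> g) \<triangle> k) \<diamondop> (i \<triangle> j)) =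
        (a \<triangle> b) \<diamondop> (((u \<triangle> g) \<triangle> c) \<diamondop> (i \<triangle> (k \<diamondop> j)))"
    using assms by (simp only: double_slide white_closed)
  also have "\<dots> = (a \<triangle> b) \<diamondop> ((u \<triangle> (g \<triangle> c)) \<diamondop> (i \<triangle> (k \<diamondop> j)))"
    using assms by (simp only: white_assoc)
  also have "\<dots> = (a \<triangle> (b \<diamondop> (g \<triangle> c))) \<diamondop> ((u \<triangle> k) \<diamondop> (i \<triangle> j))"
    using assms by (simp only: double_slide white_closed)
  finally show ?thesis .
qed

text \<open>
  The entry \<open>g\<close> is extracted with \<open>k\<close> as the last entry of the row and reinserted with \<open>f \<triangle> k\<close> as
  the last entry.
\<close>
lemma commute_in_row:
  assumes "a \<in> S" "b \<in> S" "c \<in> S" "u \<in> S" "f \<in> S" "g \<in> S" "k \<in> S" "i \<in> S" "j \<in> S"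
  shows "(a \<triangle> (b \<diamondop> c)) \<diamondop> ((u \<triangle> ((f \<triangle> g) \<triangle> k)) \<diamondop> (i \<triangle> j)) =
         (a \<triangle> (b \<diamondop> c)) \<diamondop> ((u \<triangle> ((g \<triangle> f) \<triangle> k)) \<diamondop> (i \<triangle> j))"
proof -
  have "(a \<triangle> (b \<diamondop> c)) \<diamondop> ((u \<triangle> ((f \<triangle> g) \<triangle> k)) \<diamondop> (i \<triangle> j)) =
        (a \<triangle> (b \<diamondop> c)) \<diamondop> ((((u \<triangle> f) \<triangle> g) \<triangle> k) \<diamondop> (i \<triangle> j))"
    using assms by (simp add: white_assoc white_closed)
  also have "\<dots> = (a \<triangle> (b \<diamondop> (g \<triangle> c))) \<diamondop> (((u \<triangle> f) \<triangle> k) \<diamondop> (i \<triangle> j))"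
    using assms by (simp only: extract_from_row white_closed)
  also have "\<dots> = (a \<triangle> (b \<diamondop> (g \<triangle> c))) \<diamondop> ((u \<triangle> (f \<triangle> k)) \<diamondop> (i \<triangle> j))"
    using assms by (simp only: white_assoc)
  also have "\<dots> = (a \<triangle> (b \<diamondop> c)) \<diamondop> (((u \<triangle> g) \<triangle> (f \<triangle> k)) \<diamondop> (i \<triangle> j))"
    using assms by (simp only: extract_from_row white_closed)
  also have "\<dots> = (a \<triangle> (b \<diamondop> c)) \<diamondop> ((u \<triangle> ((g \<triangle> f) \<triangle> k)) \<diamondop> (i \<triangle> j))"
    using assms by (simp add: white_assoc white_closed)
  finally show ?thesis .
qed

end

theorem theorem5p6:
  fixes S :: "'s set"
    and white :: "'s \<Rightarrow> 's \<Rightarrow> 's"  (infixl \<open>\<triangle>\<close> 70)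
    and black :: "'s \<Rightarrow> 's \<Rightarrow> 's"  (infixl \<open>\<diamondop>\<close> 70)
    and a b c d e f g h i j :: 's
  assumes "double_interchange_semigroup S (\<triangle>) (\<diamondop>)"
    and "a \<in> S" "b \<in> S" "c \<in> S" "d \<in> S" "e \<in> S"
    and "f \<in> S" "g \<in> S" "h \<in> S" "i \<in> S" "j \<in> S"
  shows "(a \<triangle> (b \<diamondop> c)) \<diamondop> (((d \<triangle> e) \<diamondop> i) \<triangle> (((f \<triangle> g) \<triangle> h) \<diamondop> j))
       = (a \<triangle> (b \<diamondop> c)) \<diamondop> (((d \<triangle> e) \<diamondop> i) \<triangle> (((g \<triangle> f) \<triangle> h) \<diamondop> j))"
proof -
  interpret double_interchange_semigroup S "(\<triangle>)" "(\<diamondop>)"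
    by (rule assms(1))
  have lower_rows: "((d \<triangle> e) \<diamondop> i) \<triangle> (((x \<triangle> y) \<triangle> h) \<diamondop> j) =
        ((d \<triangle> e) \<triangle> ((x \<triangle> y) \<triangle> h)) \<diamondop> (i \<triangle> j)" if "x \<in> S" "y \<in> S" for x y
    using assms that by (simp only: interchange white_closed)
  show ?thesis
    using assms by (simp only: lower_rows commute_in_row[of a b c "d \<triangle> e" f g h i j] white_closed)
qed

end
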